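(* Let $\mathbf{A}\in\mathbb{R}^{N\times N}$ be diagonalizable with eigendecomposition $\mathbf{A}=\mathbf{V}\boldsymbol{\Lambda}\mathbf{V}^{-1}$, and let $\mathbf{A}_\phi=\mathbf{V}\boldsymbol{\Lambda}_\phi\mathbf{V}^{-1}$ be an associated graph shift operator. For $\mathbf{z}\in\mathbb{C}^N$ write $\mathbf{z}_{\mathcal{F}}=\mathbf{V}^{-1}\mathbf{z}$. Then for every graph signal $\mathbf{x}\in\mathbb{C}^N$ and every integer $k\ge 0$, $$\left\|(\mathbf{A}_\phi^k\mathbf{x})_{\mathcal{F}}\right\|_2^2=\left\|\mathbf{x}_{\mathcal{F}}\right\|_2^2 .$$
   Context: A graph on $N$ nodes is given by a real weighted adjacency matrix $\mathbf{A}\in\mathbb{R}^{N\times N}$ (directed or undirected), assumed diagonalizable (over $\mathbb{C}$), $\mathbf{A}=\mathbf{V}\boldsymbol{\Lambda}\mathbf{V}^{-1}$ with $\mathbf{V}\in\mathbb{C}^{N\times N}$ invertible and $\boldsymbol{\Lambda}$ diagonal. A graph signal is a vector in $\mathbb{C}^N$. Graph shift operator: $\mathbf{A}_\phi=\mathbf{V}\boldsymbol{\Lambda}_\phi\mathbf{V}^{-1}$ with $\boldsymbol{\Lambda}_\phi=\mathrm{diag}(e^{j\phi_1},\dots,e^{j\phi_N})$, where $j=\sqrt{-1}$ and $\phi_1,\dots,\phi_N\in[0,2\pi]$ are arbitrary phases with $\phi_k\ne\phi_l$ for $k\neq l$. The vector $\mathbf{x}_{\mathcal F}=\mathbf{V}^{-1}\mathbf{x}$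 is called the graph Fourier transform of $\mathbf{x}$. $\|\cdot\|_2$ is the Euclidean norm. *)

theory Defs
  imports "HOL-Analysis.Analysis"
begin

definition diag_matrix :: "('n::finite \<Rightarrow> 'a::zero) \<Rightarrow> 'a^'n^'n" where
  "diag_matrix d = (\<chi> i j. if i = j then d i else 0)"

(* The library's power operation on type vec acts componentwise (via the componentwise
   product), so the power with respect to the matrix product is defined separately. *)
primrec matrix_power :: "'a::semiring_1^'n^'n \<Rightarrow> nat \<Rightarrow> 'a^'n^'n" where
  "matrix_power M 0 = mat 1"
| "matrix_power M (Suc k) = M ** matrix_power M k"

definition eigendecomposition ::
  "real^'n^'n \<Rightarrow> complex^'n^'n \<Rightarrow> ('n::finite \<Rightarrow> complex) \<Rightarrow> bool" where
  "eigendecomposition A V \<mu> \<longleftrightarrow>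
     invertible V \<and> map_matrix complex_of_real A = V ** diag_matrix \<mu> ** matrix_inv V"

definition graph_shift :: "complex^'n^'n \<Rightarrow> ('n::finite \<Rightarrow> real) \<Rightarrow> complex^'n^'n" where
  "graph_shift V \<phi> =
     V ** diag_matrix (\<lambda>i. exp (\<i> * complex_of_real (\<phi> i))) ** matrix_inv V"

definition graph_fourier :: "complex^'n^'n \<Rightarrow> complex^'n \<Rightarrow> complex^'n" where
  "graph_fourier V x = matrix_inv V *v x"

end

theory Submission
  imports Defs
begin

text \<open>Since \<open>graph_shift V \<phi>\<close> is diagonal in the basis of columns of
  \<open>V\<close>, applying it once multiplies the i-th Fourier coefficient by
  \<open>exp (\<i> * \<phi> i)\<close> (\<open>graph_fourier_graph_shift\<close>). The phases are
  real, so these factors have modulus one and the norm of the transform is unchanged. Iterating this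
  for an arbitrary signal gives all powers.\<close>

text \<open>In the Fourier domain the shift is multiplication by the diagonal matrix of its
  eigenvalues, which all have modulus one.\<close>

lemma diag_matrix_mult_vector:
  fixes d :: "'n::finite \<Rightarrow> 'a::semiring_1"
  shows "diag_matrix d *v x = (\<chi> i. d i * x $ i)"
  by (simp add: diag_matrix_def matrix_vector_mult_def vec_eq_iff if_distrib[where f = "\<lambda>a. a * _"]
      cong: if_cong)

lemma norm_diag_matrix_mult_vector:
  fixes d :: "'n::finite \<Rightarrow> 'a::real_normed_field"
  assumes "\<And>i. norm (d i) = 1"
  shows "norm (diag_matrix d *v x) = norm x"
  by (simp add: diag_matrix_mult_vector norm_vec_def norm_mult assms)

lemma graph_fourier_graph_shift:
  assumes "invertible V"
  shows "graph_fourier V (graph_shift V \<phi> *v x)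
       = diag_matrix (\<lambda>i. exp (\<i> * complex_of_real (\<phi> i))) *v graph_fourier V x"
proof -
  \<comment> \<open>\<open>matrix_inv\<close> is a Hilbert choice; invertibility provides the
    witness that makes it a genuine inverse.\<close>
  have "matrix_inv V ** V = mat 1"
    using assms unfolding invertible_def matrix_inv_def by (metis (mono_tags, lifting) someI_ex)
  then have "matrix_inv V ** graph_shift V \<phi>
      = diag_matrix (\<lambda>i. exp (\<i> * complex_of_real (\<phi> i))) ** matrix_inv V"
    by (simp add: graph_shift_def matrix_mul_assoc)
  then show ?thesis
    by (simp add: graph_fourier_def matrix_vector_mul_assoc)
qed

lemma norm_graph_fourier_graph_shift:
  assumes "invertible V"
  shows "norm (graph_fourier V (graph_shift V \<phi> *v x)) = norm (graph_fourier V x)"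
  by (simp add: graph_fourier_graph_shift[OF assms] norm_diag_matrix_mult_vector)

text \<open>Reading associativity from right to left peels off the outermost shift, so the one-step
  result applies to the signal already shifted \<open>k\<close> times.\<close>

lemma norm_graph_fourier_graph_shift_power:
  assumes "invertible V"
  shows "norm (graph_fourier V (matrix_power (graph_shift V \<phi>) k *v x)) = norm (graph_fourier V x)"
  by (induction k)
    (simp_all add: norm_graph_fourier_graph_shift[OF assms] flip: matrix_vector_mul_assoc)

theorem mainTheorem1:
  fixes A :: "real^'n^'n"
    and V :: "complex^'n^'n"
    and \<mu> :: "'n::finite \<Rightarrow> complex"
    and \<phi> :: "'n \<Rightarrow> real"
    and x :: "complex^'n"
    and k :: nat
  assumes "eigendecomposition A V \<mu>"
    and "\<And>i. \<phi> i \<in> {0..2 * pi}"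
    and "\<And>i l. i \<noteq> l \<Longrightarrow> \<phi> i \<noteq> \<phi> l"
  shows "(norm (graph_fourier V (matrix_power (graph_shift V \<phi>) k *v x)))\<^sup>2
       = (norm (graph_fourier V x))\<^sup>2"
  using assms(1) by (simp add: eigendecomposition_def norm_graph_fourier_graph_shift_power)

end
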